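(* Let $A:[0,1]^2\to[0,1]$ be an aggregation function that is left-continuous with respect to its second variable and has $1$ as a left neutral element ($A(1,x)=x$ for all $x$), and let $I$ be a fuzzy implication satisfying $I(1,y)=y$ for all $y\in[0,1]$. Let $I_A(x,y)=\sup\{z\in[0,1]\mid A(x,z)\leq y\}$. For nonempty sets $U,V$, fuzzy sets $D,D'$ on $U$ and $B$ on $V$, define $B'(y)=\sup_{x\in U}A(D'(x),I(D(x),B(y)))$. Then the following are equivalent: (a) $I(x,y)\leq I_A(x,y)$ for all $x,y\in[0,1]$; (b) for all nonempty $U,V$ and all fuzzy sets $D,D',D''$ on $U$, $B$ on $V$ (with $B''$ the conclusion obtained from $D''$): if $D'$ is normal then $B\subseteq B'$; if $D'\subseteq D''$ then $B'\subseteq B''$; if $D^C$ is normal and $D'=D^C$ then $B'(y)=1$ for all $y$; and if $D$ is normal and $D'=D$ then $B'=B$.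
   Context: An aggregation function is $A:[0,1]^2\to[0,1]$ non-decreasing in each variable with $A(0,0)=0$, $A(1,1)=1$. A fuzzy implication is a function $[0,1]^2\to[0,1]$ non-increasing in the first variable, non-decreasing in the second, with $I(0,0)=I(1,1)=1$, $I(1,0)=0$. Fuzzy sets on $U$ are maps $U\to[0,1]$; inclusion is pointwise; normal means attaining the value $1$; $D^C(x)=1-D(x)$. *)

theory Defs
  imports Complex_Main "HOL-Library.FuncSet"
begin

text \<open>Binary operations on the unit interval are functions \<open>real \<Rightarrow> real \<Rightarrow> real\<close> of which only
  the values on \<open>{0..1}\<close> are constrained.\<close>

definition aggregation_function :: "(real \<Rightarrow> real \<Rightarrow> real) \<Rightarrow> bool" where
  "aggregation_function A \<longleftrightarrow>
     (\<forall>x\<in>{0..1}. \<forall>y\<in>{0..1}. A x y \<in> {0..1}) \<and>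
     (\<forall>y\<in>{0..1}. mono_on {0..1} (\<lambda>x. A x y)) \<and>
     (\<forall>x\<in>{0..1}. mono_on {0..1} (\<lambda>y. A x y)) \<and>
     A 0 0 = 0 \<and> A 1 1 = 1"

definition fuzzy_implication :: "(real \<Rightarrow> real \<Rightarrow> real) \<Rightarrow> bool" where
  "fuzzy_implication I \<longleftrightarrow>
     (\<forall>x\<in>{0..1}. \<forall>y\<in>{0..1}. I x y \<in> {0..1}) \<and>
     (\<forall>y\<in>{0..1}. antimono_on {0..1} (\<lambda>x. I x y)) \<and>
     (\<forall>x\<in>{0..1}. mono_on {0..1} (\<lambda>y. I x y)) \<and>
     I 0 0 = 1 \<and> I 1 1 = 1 \<and> I 1 0 = 0"

text \<open>At the point \<open>0\<close> left-continuity on the unit interval is vacuous, so \<open>y\<close> ranges over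
  \<open>{0<..1}\<close>; there the filter \<open>at_left y\<close> only sees points of the interval.\<close>

definition left_continuous_snd :: "(real \<Rightarrow> real \<Rightarrow> real) \<Rightarrow> bool" where
  "left_continuous_snd A \<longleftrightarrow>
     (\<forall>x\<in>{0..1}. \<forall>y\<in>{0<..1}. continuous (at_left y) (\<lambda>z. A x z))"

text \<open>\<open>Sup\<close> on the reals is unspecified on the empty set. If \<open>A\<close> is an aggregation function with
  left neutral element \<open>1\<close>, then \<open>A x 0 \<le> A 1 0 = 0\<close>, so the set below contains \<open>0\<close> for all
  \<open>x\<close> and \<open>y\<close> in the unit interval.\<close>

definition residual :: "(real \<Rightarrow> real \<Rightarrow> real) \<Rightarrow> real \<Rightarrow> real \<Rightarrow> real" where
  "residual A x y = Sup {z \<in> {0..1}. A x z \<le> y}"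

text \<open>A fuzzy set on a carrier \<open>U\<close> is a function whose values outside \<open>U\<close> are irrelevant.
  Consequently inclusion and equality of fuzzy sets are relativised to the carrier.\<close>

definition fuzzy_set :: "'a set \<Rightarrow> ('a \<Rightarrow> real) \<Rightarrow> bool" where
  "fuzzy_set U D \<longleftrightarrow> D \<in> U \<rightarrow> {0..1}"

definition fuzzy_subset :: "'a set \<Rightarrow> ('a \<Rightarrow> real) \<Rightarrow> ('a \<Rightarrow> real) \<Rightarrow> bool" where
  "fuzzy_subset U D E \<longleftrightarrow> (\<forall>x\<in>U. D x \<le> E x)"

definition fuzzy_eq :: "'a set \<Rightarrow> ('a \<Rightarrow> real) \<Rightarrow> ('a \<Rightarrow> real) \<Rightarrow> bool" where
  "fuzzy_eq U D E \<longleftrightarrow> (\<forall>x\<in>U. D x = E x)"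

definition normal_fuzzy :: "'a set \<Rightarrow> ('a \<Rightarrow> real) \<Rightarrow> bool" where
  "normal_fuzzy U D \<longleftrightarrow> (\<exists>x\<in>U. D x = 1)"

definition fuzzy_compl :: "('a \<Rightarrow> real) \<Rightarrow> 'a \<Rightarrow> real" where
  "fuzzy_compl D = (\<lambda>x. 1 - D x)"

text \<open>The conclusion \<open>B'\<close> drawn from the rule ``if \<open>D\<close> then \<open>B\<close>'' and the input \<open>D'\<close>.\<close>

definition inferred ::
  "(real \<Rightarrow> real \<Rightarrow> real) \<Rightarrow> (real \<Rightarrow> real \<Rightarrow> real) \<Rightarrow> 'u set \<Rightarrow>
   ('u \<Rightarrow> real) \<Rightarrow> ('v \<Rightarrow> real) \<Rightarrow> ('u \<Rightarrow> real) \<Rightarrow> 'v \<Rightarrow> real" where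
  "inferred A I U D B D' = (\<lambda>y. SUP x\<in>U. A (D' x) (I (D x) (B y)))"

text \<open>HOL cannot quantify over all sets at once, so ``all nonempty sets \<open>U\<close>, \<open>V\<close>'' is read as
  all nonempty subsets of two ambient types \<open>'u\<close> and \<open>'v\<close>, which are themselves arbitrary except that
  \<open>'u\<close> must have two distinct elements: if every \<open>U\<close> were a singleton, a normal \<open>D\<close> would
  be constantly \<open>1\<close> and the equivalence would fail. Singleton sets \<open>U\<close> are still
  included, as subsets.\<close>

end

theory Submission
  imports Defs
begin

text \<open>Left-continuity of \<open>A\<close> in the second variable makes the residual a genuine adjoint:
  \<open>z \<le> residual A x y\<close> iff \<open>A x z \<le> y\<close>. Hence (a) says exactly that \<open>A x (I x y) \<le> y\<close>. This bounds
  every term of the supremum defining \<open>B'\<close> when \<open>D' = D\<close>; the other three properties only need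
  monotonicity and the values at \<open>1\<close>. Conversely, a two-point \<open>U\<close> with \<open>D\<close> taking the values \<open>1\<close>
  and \<open>x\<close>, and constant \<open>B = y\<close>, turns \<open>B' = B\<close> into \<open>A x (I x y) \<le> y\<close>.\<close>

lemma aggregation_function_unit:
  assumes "aggregation_function A" "x \<in> {0..1}" "y \<in> {0..1}"
  shows "A x y \<in> {0..1}"
  using assms unfolding aggregation_function_def by blast

lemma aggregation_function_mono:
  assumes "aggregation_function A" "x \<in> {0..1}" "x' \<in> {0..1}" "y \<in> {0..1}" "y' \<in> {0..1}"
    and "x \<le> x'" "y \<le> y'"
  shows "A x y \<le> A x' y'"
proof -
  have "A x y \<le> A x' y"
    using assms unfolding aggregation_function_def mono_on_def by blast
  also have "\<dots> \<le> A x' y'"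
    using assms unfolding aggregation_function_def mono_on_def by blast
  finally show ?thesis .
qed

lemma fuzzy_implication_unit:
  assumes "fuzzy_implication I" "x \<in> {0..1}" "y \<in> {0..1}"
  shows "I x y \<in> {0..1}"
  using assms unfolding fuzzy_implication_def by blast

lemma fuzzy_implication_antimono:
  assumes "fuzzy_implication I" "x \<in> {0..1}" "x' \<in> {0..1}" "y \<in> {0..1}" "x \<le> x'"
  shows "I x' y \<le> I x y"
  using assms unfolding fuzzy_implication_def monotone_on_def by blast

text \<open>Monotonicity in the second argument puts \<open>I 0 y\<close> above
  \<open>I 0 0 = 1\<close>, and 1 is the largest possible value.\<close>

lemma fuzzy_implication_0:
  assumes I: "fuzzy_implication I" and y: "y \<in> {0..1}"
  shows "I 0 y = 1"
proof -
  have "mono_on {0..1} (I 0)" "I 0 0 = 1"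
    using I unfolding fuzzy_implication_def by auto
  then have "1 \<le> I 0 y"
    using y mono_onD[of "{0..1}" "I 0" 0 y] by auto
  then show ?thesis
    using fuzzy_implication_unit[OF I _ y, of 0] by auto
qed

text \<open>From right to left, \<open>z\<close> itself belongs to the set whose supremum is taken.
  From left to right, the supremum need not be attained a priori: every \<open>w < z\<close> lies
  below some element of the set, hence satisfies the inequality by monotonicity, and left-continuity
  carries it to \<open>z\<close>. The hypothesis \<open>A 1 0 = 0\<close> puts 0 into the set, so
  that \<open>Sup\<close> is meaningful.\<close>

lemma le_residual_iff:
  assumes A: "aggregation_function A" and lc: "left_continuous_snd A" and A1: "A 1 0 = 0"
    and x: "x \<in> {0..1}" and y: "y \<in> {0..1}" and z: "z \<in> {0..1}"
  shows "z \<le> residual A x y \<longleftrightarrow> A x z \<le> y"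
proof
  let ?S = "{z \<in> {0..1}. A x z \<le> y}"
  have bdd: "bdd_above ?S"
    by (rule bdd_aboveI[of _ 1]) auto
  show "z \<le> residual A x y" if "A x z \<le> y"
    unfolding residual_def using that z by (intro cSup_upper bdd) auto
  have "A x 0 \<le> A 1 0"
    using x by (intro aggregation_function_mono[OF A]) auto
  then have A0: "A x 0 \<le> y"
    using A1 y by auto
  then have "0 \<in> ?S"
    by simp
  then have ne: "?S \<noteq> {}"
    by blast
  assume le: "z \<le> residual A x y"
  have below: "A x w \<le> y" if w: "w \<in> {0..1}" "w < z" for w
  proof -
    have "w < Sup ?S"
      using le w unfolding residual_def by linarith
    then obtain v where v: "v \<in> ?S" "w < v"
      using less_cSup_iff[OF ne bdd] by blast
    have "A x w \<le> A x v"
      using v w x by (intro aggregation_function_mono[OF A]) auto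
    then show ?thesis
      using v by auto
  qed
  show "A x z \<le> y"
  \<comment> \<open>At 0 there is nothing in the unit interval to approach from the left, so this
    point is settled by \<open>A x 0 \<le> y\<close> instead of a limit.\<close>
  proof (cases "z = 0")
    case True
    then show ?thesis
      using A0 by simp
  next
    case False
    then have z': "z \<in> {0<..1}"
      using z by auto
    then have "((\<lambda>w. A x w) \<longlongrightarrow> A x z) (at_left z)"
      using lc x unfolding left_continuous_snd_def continuous_within by blast
    moreover have "\<forall>\<^sub>F w in at_left z. A x w \<le> y"
      using eventually_at_left_real[of 0 z] z'
      by (auto elim!: eventually_mono intro!: below)
    ultimately show ?thesis
      by (intro tendsto_upperbound[of _ _ "at_left z"]) auto
  qed
qed

text \<open>A real supremum dominates its terms only if they are bounded above; here 1 is a bound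
  because \<open>A\<close> and \<open>I\<close> stay in the unit interval.\<close>

lemma inferred_upper:
  assumes A: "aggregation_function A" and I: "fuzzy_implication I"
    and D: "fuzzy_set U D" "fuzzy_set U D'" and b: "B y \<in> {0..1}" and x: "x \<in> U"
  shows "A (D' x) (I (D x) (B y)) \<le> inferred A I U D B D' y"
  unfolding inferred_def
proof (rule cSUP_upper[OF x bdd_aboveI2[of _ _ 1]])
  fix u assume "u \<in> U"
  then have "D u \<in> {0..1}" "D' u \<in> {0..1}"
    using D unfolding fuzzy_set_def by auto
  then show "A (D' u) (I (D u) (B y)) \<le> 1"
    using aggregation_function_unit[OF A] fuzzy_implication_unit[OF I] b by simp
qed

lemma inferred_least:
  assumes "U \<noteq> {}" "\<And>x. x \<in> U \<Longrightarrow> A (D' x) (I (D x) (B y)) \<le> c"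
  shows "inferred A I U D B D' y \<le> c"
  unfolding inferred_def using assms by (rule cSUP_least)

text \<open>The comparison is made term by term: \<open>A\<close> is monotone in its first argument,
  and \<open>I (D x) (B y)\<close> is the same on both sides.\<close>

lemma inferred_mono:
  assumes A: "aggregation_function A" and I: "fuzzy_implication I"
    and D: "fuzzy_set U D" "fuzzy_set U D'" "fuzzy_set U D''" and B: "fuzzy_set V B"
    and ne: "U \<noteq> {}" and sub: "fuzzy_subset U D' D''"
  shows "fuzzy_subset V (inferred A I U D B D') (inferred A I U D B D'')"
  unfolding fuzzy_subset_def
proof (intro ballI inferred_least[OF ne])
  fix y x assume "y \<in> V" and x: "x \<in> U"
  then have b: "B y \<in> {0..1}" and d: "D x \<in> {0..1}" "D' x \<in> {0..1}" "D'' x \<in> {0..1}"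
    using B D unfolding fuzzy_set_def by auto
  have "A (D' x) (I (D x) (B y)) \<le> A (D'' x) (I (D x) (B y))"
    using sub x unfolding fuzzy_subset_def
    by (intro aggregation_function_mono[OF A] fuzzy_implication_unit[OF I] b d) auto
  also have "\<dots> \<le> inferred A I U D B D'' y"
    by (rule inferred_upper[where B = B and y = y, OF A I D(1,3) b x])
  finally show "A (D' x) (I (D x) (B y)) \<le> inferred A I U D B D'' y" .
qed

text \<open>One term of the supremum suffices. Where \<open>D'\<close> is 1, neutrality reduces the
  term to \<open>I (D x) (B y)\<close>, and this is at least \<open>I 1 (B y) = B y\<close> because
  \<open>I\<close> decreases in its first argument.\<close>

lemma subset_inferred:
  assumes A: "aggregation_function A" and I: "fuzzy_implication I"
    and A1: "\<forall>x\<in>{0..1}. A 1 x = x" and I1: "\<forall>y\<in>{0..1}. I 1 y = y"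
    and D: "fuzzy_set U D" "fuzzy_set U D'" and B: "fuzzy_set V B"
    and norm: "normal_fuzzy U D'"
  shows "fuzzy_subset V B (inferred A I U D B D')"
  unfolding fuzzy_subset_def
proof
  fix y assume "y \<in> V"
  then have b: "B y \<in> {0..1}"
    using B unfolding fuzzy_set_def by auto
  obtain x where x: "x \<in> U" "D' x = 1"
    using norm unfolding normal_fuzzy_def by blast
  then have d: "D x \<in> {0..1}"
    using D unfolding fuzzy_set_def by auto
  have "B y = I 1 (B y)"
    using I1 b by simp
  also have "\<dots> \<le> I (D x) (B y)"
    using d by (intro fuzzy_implication_antimono[OF I _ _ b]) auto
  also have "\<dots> = A (D' x) (I (D x) (B y))"
    using A1 x fuzzy_implication_unit[OF I d b] by simp
  also have "\<dots> \<le> inferred A I U D B D' y"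
    by (rule inferred_upper[where B = B and y = y, OF A I D b x(1)])
  finally show "B y \<le> inferred A I U D B D' y" .
qed

text \<open>At a point where the complement of \<open>D\<close> is 1, \<open>D\<close> is 0, so the
  term is \<open>A 1 (I 0 (B y)) = A 1 1 = 1\<close>, the largest value any term can take.\<close>

lemma inferred_compl:
  assumes A: "aggregation_function A" and I: "fuzzy_implication I"
    and D: "fuzzy_set U D" "fuzzy_set U D'" and b: "B y \<in> {0..1}"
    and norm: "normal_fuzzy U (fuzzy_compl D)" and eq: "fuzzy_eq U D' (fuzzy_compl D)"
  shows "inferred A I U D B D' y = 1"
proof (rule antisym)
  obtain x where x: "x \<in> U" "D x = 0" "D' x = 1"
    using norm eq unfolding normal_fuzzy_def fuzzy_eq_def fuzzy_compl_def by force
  have "A (D' x) (I (D x) (B y)) = 1"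
    using x fuzzy_implication_0[OF I b] A unfolding aggregation_function_def by simp
  then show "1 \<le> inferred A I U D B D' y"
    using inferred_upper[where B = B and y = y, OF A I D b x(1)] by simp
  show "inferred A I U D B D' y \<le> 1"
  proof (rule inferred_least)
    show "U \<noteq> {}"
      using x by auto
    fix u assume "u \<in> U"
    then have "D u \<in> {0..1}" "D' u \<in> {0..1}"
      using D unfolding fuzzy_set_def by auto
    then show "A (D' u) (I (D u) (B y)) \<le> 1"
      using aggregation_function_unit[OF A] fuzzy_implication_unit[OF I] b by simp
  qed
qed

text \<open>The lower bound comes from \<open>subset_inferred\<close>, since \<open>D'\<close>
  inherits normality from \<open>D\<close>. For the upper bound, \<open>AI\<close> at
  \<open>D x\<close> and \<open>B y\<close> bounds every term by \<open>B y\<close>.\<close>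

lemma inferred_self:
  assumes A: "aggregation_function A" and I: "fuzzy_implication I"
    and A1: "\<forall>x\<in>{0..1}. A 1 x = x" and I1: "\<forall>y\<in>{0..1}. I 1 y = y"
    and AI: "\<And>x y. x \<in> {0..1} \<Longrightarrow> y \<in> {0..1} \<Longrightarrow> A x (I x y) \<le> y"
    and D: "fuzzy_set U D" "fuzzy_set U D'" and B: "fuzzy_set V B"
    and norm: "normal_fuzzy U D" and eq: "fuzzy_eq U D' D"
  shows "fuzzy_eq V (inferred A I U D B D') B"
  unfolding fuzzy_eq_def
proof (intro ballI antisym)
  fix y assume y: "y \<in> V"
  have norm': "normal_fuzzy U D'" and ne: "U \<noteq> {}"
    using norm eq unfolding normal_fuzzy_def fuzzy_eq_def by auto
  show "B y \<le> inferred A I U D B D' y"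
    using subset_inferred[OF A I A1 I1 D B norm'] y unfolding fuzzy_subset_def by blast
  show "inferred A I U D B D' y \<le> B y"
  proof (rule inferred_least[OF ne])
    fix x assume x: "x \<in> U"
    then have "D x \<in> {0..1}" "B y \<in> {0..1}"
      using D B y unfolding fuzzy_set_def by blast+
    then show "A (D' x) (I (D x) (B y)) \<le> B y"
      using AI eq x unfolding fuzzy_eq_def by simp
  qed
qed

theorem theorem4p7:
  fixes A I :: "real \<Rightarrow> real \<Rightarrow> real"
  assumes "aggregation_function A"
    and "left_continuous_snd A"
    and "\<forall>x\<in>{0..1}. A 1 x = x"
    and "fuzzy_implication I"
    and "\<forall>y\<in>{0..1}. I 1 y = y"
    and ambient: "\<exists>u u' :: 'u. u \<noteq> u'"
  shows "(\<forall>x\<in>{0..1}. \<forall>y\<in>{0..1}. I x y \<le> residual A x y) \<longleftrightarrow>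
    (\<forall>(U :: 'u set) (V :: 'v set) D D' D'' B.
       U \<noteq> {} \<and> V \<noteq> {} \<and>
       fuzzy_set U D \<and> fuzzy_set U D' \<and> fuzzy_set U D'' \<and> fuzzy_set V B \<longrightarrow>
         (normal_fuzzy U D' \<longrightarrow> fuzzy_subset V B (inferred A I U D B D')) \<and>
         (fuzzy_subset U D' D'' \<longrightarrow>
            fuzzy_subset V (inferred A I U D B D') (inferred A I U D B D'')) \<and>
         (normal_fuzzy U (fuzzy_compl D) \<and> fuzzy_eq U D' (fuzzy_compl D) \<longrightarrow>
            (\<forall>y\<in>V. inferred A I U D B D' y = 1)) \<and>
         (normal_fuzzy U D \<and> fuzzy_eq U D' D \<longrightarrow>
            fuzzy_eq V (inferred A I U D B D') B))"
proof
  \<comment> \<open>The adjunction with \<open>z = I x y\<close>; the value \<open>A 1 0 = 0\<close>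
    is neutrality of 1 at the point 0.\<close>
  have AI_iff: "I x y \<le> residual A x y \<longleftrightarrow> A x (I x y) \<le> y"
    if "x \<in> {0..1}" "y \<in> {0..1}" for x y
    using that assms(3) by (intro le_residual_iff assms(1,2) fuzzy_implication_unit[OF assms(4)]) auto
  {
    assume "\<forall>x\<in>{0..1}. \<forall>y\<in>{0..1}. I x y \<le> residual A x y"
    then have AI: "A x (I x y) \<le> y" if "x \<in> {0..1}" "y \<in> {0..1}" for x y
      using that AI_iff by blast
    show "(\<forall>(U :: 'u set) (V :: 'v set) D D' D'' B.
       U \<noteq> {} \<and> V \<noteq> {} \<and>
       fuzzy_set U D \<and> fuzzy_set U D' \<and> fuzzy_set U D'' \<and> fuzzy_set V B \<longrightarrow>
         (normal_fuzzy U D' \<longrightarrow> fuzzy_subset V B (inferred A I U D B D')) \<and>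
         (fuzzy_subset U D' D'' \<longrightarrow>
            fuzzy_subset V (inferred A I U D B D') (inferred A I U D B D'')) \<and>
         (normal_fuzzy U (fuzzy_compl D) \<and> fuzzy_eq U D' (fuzzy_compl D) \<longrightarrow>
            (\<forall>y\<in>V. inferred A I U D B D' y = 1)) \<and>
         (normal_fuzzy U D \<and> fuzzy_eq U D' D \<longrightarrow>
            fuzzy_eq V (inferred A I U D B D') B))"
    proof (intro allI impI conjI; elim conjE)
      fix U :: "'u set" and V :: "'v set" and D D' D'' B
      assume U: "U \<noteq> {}" and D: "fuzzy_set U D" and D': "fuzzy_set U D'"
        and D'': "fuzzy_set U D''" and B: "fuzzy_set V B"
      show "fuzzy_subset V B (inferred A I U D B D')" if "normal_fuzzy U D'"
        by (rule subset_inferred[OF assms(1,4,3,5) D D' B that])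
      show "fuzzy_subset V (inferred A I U D B D') (inferred A I U D B D'')"
        if "fuzzy_subset U D' D''"
        by (rule inferred_mono[OF assms(1,4) D D' D'' B U that])
      show "\<forall>y\<in>V. inferred A I U D B D' y = 1"
        if "normal_fuzzy U (fuzzy_compl D)" "fuzzy_eq U D' (fuzzy_compl D)"
        using that B unfolding fuzzy_set_def
        by (intro ballI inferred_compl[OF assms(1,4) D D']) auto
      show "fuzzy_eq V (inferred A I U D B D') B" if "normal_fuzzy U D" "fuzzy_eq U D' D"
        by (rule inferred_self[OF assms(1,4,3,5) AI D D' B that])
    qed
  }
  assume R: "(\<forall>(U :: 'u set) (V :: 'v set) D D' D'' B.
       U \<noteq> {} \<and> V \<noteq> {} \<and>
       fuzzy_set U D \<and> fuzzy_set U D' \<and> fuzzy_set U D'' \<and> fuzzy_set V B \<longrightarrow>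
         (normal_fuzzy U D' \<longrightarrow> fuzzy_subset V B (inferred A I U D B D')) \<and>
         (fuzzy_subset U D' D'' \<longrightarrow>
            fuzzy_subset V (inferred A I U D B D') (inferred A I U D B D'')) \<and>
         (normal_fuzzy U (fuzzy_compl D) \<and> fuzzy_eq U D' (fuzzy_compl D) \<longrightarrow>
            (\<forall>y\<in>V. inferred A I U D B D' y = 1)) \<and>
         (normal_fuzzy U D \<and> fuzzy_eq U D' D \<longrightarrow>
            fuzzy_eq V (inferred A I U D B D') B))"
  show "\<forall>x\<in>{0..1}. \<forall>y\<in>{0..1}. I x y \<le> residual A x y"
  proof (intro ballI)
    fix x y :: real
    assume xy: "x \<in> {0..1}" "y \<in> {0..1}"
    obtain u u' :: 'u where u: "u \<noteq> u'"
      using ambient by blast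
    define U where "U = {u, u'}"
    \<comment> \<open>The point \<open>u\<close> makes \<open>D\<close> normal whatever
      \<open>x\<close> is, while \<open>u' \<noteq> u\<close> leaves
      \<open>D u' = x\<close>.\<close>
    define D where "D = (\<lambda>w. if w = u then 1 else x)"
    define B where "B = (\<lambda>_ :: 'v. y)"
    have D: "fuzzy_set U D" and B: "fuzzy_set UNIV B"
      using xy by (auto simp: fuzzy_set_def D_def B_def)
    \<comment> \<open>The fourth property is now applied with \<open>D' = D\<close> and with
      \<open>V\<close> the whole type, which is nonempty since every type is inhabited.\<close>
    have "U \<noteq> {}" "normal_fuzzy U D" "fuzzy_eq U D D"
      by (auto simp: U_def normal_fuzzy_def D_def fuzzy_eq_def)
    then have "fuzzy_eq UNIV (inferred A I U D B D) B"
      using R[rule_format, of U UNIV D D D B] D B by simp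
    then have "inferred A I U D B D v = y" for v
      by (simp add: fuzzy_eq_def B_def)
    \<comment> \<open>The term at \<open>u'\<close> is \<open>A x (I x y)\<close>, and the supremum
      above it has just been found to be \<open>y\<close>.\<close>
    moreover have "A (D u') (I (D u') (B v)) \<le> inferred A I U D B D v" for v
      using D xy by (intro inferred_upper assms(1,4)) (auto simp: B_def U_def)
    ultimately have "A x (I x y) \<le> y"
      using u by (simp add: D_def B_def)
    then show "I x y \<le> residual A x y"
      using AI_iff xy by blast
  qed
qed

end
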